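(* Let $r\ge3$ and let $\Lambda$ be an AR language on an $r$-letter alphabet $\mathcal A=\{a_1,\dots,a_r\}$. Denote by $(a),(b),(c)$ the first three distinct rules by order of appearance. Let $\lambda_2$ be the stage of the first rule $(c)$, $\lambda_a$ (resp. $\lambda_b$) the stage of the last rule $(a)$ (resp. $(b)$) before $\lambda_2$, $\mu_a$ (resp. $\mu_b$) the stage of the first rule $(a)$ (resp. $(b)$) after $\lambda_2$, and let $x,y$ be the elements of $\{a,b\}$ with $\mu_x<\mu_y$. Let $v$ be a word of $\Lambda$ of length at least $$|w_{\lambda_2}|+\max_{1\le i\le r}|A^{(i)}_{\mu_y+1}|+1.$$ Then $v$ cannot cluster for any permutation and any order on the alphabet. For the $4$-Bonacci language this bound is not optimal; the better bound $|w_{\lambda_y}|+\max_{1\le i\le r}|A^{(i)}_{\mu_y+1}|+1$ holds for it (no word of the $4$-Bonacci language of at least this length clusters for any permutation and any order), but is not optimal either (no word of the $4$-Bonacci language of length equal to this better bound minus $1$ clusters for any permutation and any order).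
   Context: AR languages on $r$ letters. Given an infinite sequence of rules, each of the form $(a_i)$ with $1\le i\le r$, and such that each of the $r$ rules is used infinitely many times, define words $A_k^{(i)}$, $1\le i\le r$, $k\ge0$, by $A_0^{(i)}=a_i$ and, by rule $(a_i)$ at stage $k$, $A_{k+1}^{(i)}=A_k^{(i)}$ and $A_{k+1}^{(j)}=A_k^{(j)}A_k^{(i)}$ for all $j\ne i$. The AR language $\Lambda$ is the set of all factors of the words $A_k^{(i)}$. Its directive word is the sequence of letters naming the rules at stages $0,1,2,\dots$. The words $w_k$ are given by: $w_0$ is the empty word and $w_{k+1}=w_kA_k^{(i)}$ if the rule at stage $k$ is $(a_i)$. The $4$-Bonacci language is the AR language on four letters with directive word $(a_1a_2a_3a_4)^\omega$. Clustering. For a total order on the alphabet, with letters listed increasingly as $e_1<\dots<e_r$, the Burrows-Wheeler transform $B(w)$ of a word $w=w_1\cdots w_n$ is obtained by listing its $n$ cyclic conjugates $w_i\cdots w_nw_1\cdots w_{i-1}$ (with multiplicity) in nondecreasing lexicographical order and reading the sequence of their last letters. The word $w$ clusters for this order and a permutation $\pi\neq \mathrm{Id}$ of the alphabet if $B(w)=(\pi e_1)^{n_{\pi e_1}}\cdots(\pi e_r)^{n_{\pi e_r}}$, where $n_e\ge0$ is the number of occurrences of $e$ in $w$. *)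

theory Defs
  imports Complex_Main "HOL-Library.Multiset" "HOL-Library.Sublist" "HOL-Combinatorics.Permutations"
begin

text \<open>
  Letters are the elements of a finite set \<open>A\<close>, and a directive word is a sequence
  \<open>d :: nat \<Rightarrow> 'a\<close>, the rule at stage \<open>k\<close> being \<open>(d k)\<close>.
  The word \<open>A_k^(i)\<close> is \<open>AR_word d k i\<close>, with the letter \<open>i\<close> itself as index.
\<close>

definition AR_directive :: "'a set \<Rightarrow> (nat \<Rightarrow> 'a) \<Rightarrow> bool" where
  "AR_directive A d \<longleftrightarrow> range d \<subseteq> A \<and> (\<forall>i\<in>A. infinite {k. d k = i})"

primrec AR_word :: "(nat \<Rightarrow> 'a) \<Rightarrow> nat \<Rightarrow> 'a \<Rightarrow> 'a list" where
  "AR_word d 0 j = [j]"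
| "AR_word d (Suc k) j =
     (if j = d k then AR_word d k j else AR_word d k j @ AR_word d k (d k))"

definition AR_language :: "'a set \<Rightarrow> (nat \<Rightarrow> 'a) \<Rightarrow> 'a list set" where
  "AR_language A d = {v. \<exists>k. \<exists>i\<in>A. sublist v (AR_word d k i)}"

primrec AR_w :: "(nat \<Rightarrow> 'a) \<Rightarrow> nat \<Rightarrow> 'a list" where
  "AR_w d 0 = []"
| "AR_w d (Suc k) = AR_w d k @ AR_word d k (d k)"

definition AR_maxlen :: "'a set \<Rightarrow> (nat \<Rightarrow> 'a) \<Rightarrow> nat \<Rightarrow> nat" where
  "AR_maxlen A d k = Max ((\<lambda>i. length (AR_word d k i)) ` A)"

definition rule_a :: "(nat \<Rightarrow> 'a) \<Rightarrow> 'a" where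
  "rule_a d = d 0"

definition rule_b :: "(nat \<Rightarrow> 'a) \<Rightarrow> 'a" where
  "rule_b d = d (LEAST k. d k \<noteq> rule_a d)"

text \<open>The third distinct rule \<open>(c)\<close> is \<open>(d (lambda2 d))\<close>.\<close>

definition lambda2 :: "(nat \<Rightarrow> 'a) \<Rightarrow> nat" where
  "lambda2 d = (LEAST k. d k \<notin> {rule_a d, rule_b d})"

definition lambda_last :: "(nat \<Rightarrow> 'a) \<Rightarrow> 'a \<Rightarrow> nat" where
  "lambda_last d e = (GREATEST k. k < lambda2 d \<and> d k = e)"

definition mu_first :: "(nat \<Rightarrow> 'a) \<Rightarrow> 'a \<Rightarrow> nat" where
  "mu_first d e = (LEAST k. lambda2 d < k \<and> d k = e)"

definition bonacci4 :: "'a \<Rightarrow> 'a \<Rightarrow> 'a \<Rightarrow> 'a \<Rightarrow> nat \<Rightarrow> 'a" where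
  "bonacci4 a1 a2 a3 a4 k = [a1, a2, a3, a4] ! (k mod 4)"

text \<open>
  A total order on the alphabet is a reflexive relation \<open>R\<close> with \<open>linear_order_on A R\<close>.
  As \<open>lexord\<close> expects a strict relation, the diagonal is removed first.
\<close>

definition lex_le :: "'a rel \<Rightarrow> 'a list \<Rightarrow> 'a list \<Rightarrow> bool" where
  "lex_le R u v \<longleftrightarrow> u = v \<or> (u, v) \<in> lexord (R - Id)"

definition conjugates :: "'a list \<Rightarrow> 'a list list" where
  "conjugates w = map (\<lambda>i. rotate i w) [0..<length w]"

definition BWT :: "'a rel \<Rightarrow> 'a list \<Rightarrow> 'a list" where
  "BWT R w = map last (THE cs. mset cs = mset (conjugates w) \<and> sorted_wrt (lex_le R) cs)"

definition increasing_listing :: "'a set \<Rightarrow> 'a rel \<Rightarrow> 'a list" where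
  "increasing_listing A R = (THE es. set es = A \<and> sorted_wrt (\<lambda>x y. (x, y) \<in> R - Id) es)"

definition clusters :: "'a set \<Rightarrow> 'a rel \<Rightarrow> ('a \<Rightarrow> 'a) \<Rightarrow> 'a list \<Rightarrow> bool" where
  "clusters A R \<pi> w \<longleftrightarrow>
     BWT R w =
       concat (map (\<lambda>e. replicate (count_list w (\<pi> e)) (\<pi> e)) (increasing_listing A R))"

definition never_clusters :: "'a set \<Rightarrow> 'a list \<Rightarrow> bool" where
  "never_clusters A w \<longleftrightarrow>
     (\<forall>R \<pi>. linear_order_on A R \<and> \<pi> permutes A \<and> \<pi> \<noteq> id \<longrightarrow> \<not> clusters A R \<pi> w)"

definition clustering_bound :: "'a set \<Rightarrow> (nat \<Rightarrow> 'a) \<Rightarrow> nat \<Rightarrow> bool" where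
  "clustering_bound A d N \<longleftrightarrow> (\<forall>v\<in>AR_language A d. N \<le> length v \<longrightarrow> never_clusters A v)"

definition optimal_clustering_bound :: "'a set \<Rightarrow> (nat \<Rightarrow> 'a) \<Rightarrow> nat \<Rightarrow> bool" where
  "optimal_clustering_bound A d N \<longleftrightarrow>
     clustering_bound A d N \<and> (\<forall>M<N. \<not> clustering_bound A d M)"

text \<open>
  The two definite descriptions above denote: sorting is possible and its result is unique.
\<close>

lemma strict_total_sort_ex1:
  assumes lin: "strict_linear_order_on B S"
    and sub: "set xs \<subseteq> B"
  shows "\<exists>!ys. mset ys = mset xs \<and> sorted_wrt (\<lambda>u v. u = v \<or> (u, v) \<in> S) ys"
proof -
  let ?le = "\<lambda>u v. u = v \<or> (u, v) \<in> S"
  have tr: "trans S" and ir: "irrefl S" and tot: "total_on B S"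
    using lin by (auto simp: strict_linear_order_on_def)
  have antisym: "u = v" if "?le u v" "?le v u" for u v
    using that tr ir by (meson irrefl_def transD)
  have ex: "\<exists>ys. mset ys = mset xs \<and> sorted_wrt ?le ys"
    using sub
  proof (induction xs)
    case Nil
    then show ?case by auto
  next
    case (Cons x xs)
    then obtain ys where ys: "mset ys = mset xs" "sorted_wrt ?le ys" by auto
    have setys: "set ys \<subseteq> B"
      using Cons.prems ys(1) by (metis set_mset_mset set_subset_Cons subset_trans)
    let ?zs = "filter (\<lambda>u. (u, x) \<in> S) ys @ x # filter (\<lambda>u. (u, x) \<notin> S) ys"
    have m: "mset ?zs = mset (x # xs)"
      using ys(1) by simp
    have right: "?le x u" if "u \<in> set ys" "(u, x) \<notin> S" for u
    proof -
      have "u \<in> B" "x \<in> B" using that(1) setys Cons.prems by auto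
      with tot that(2) show ?thesis unfolding total_on_def by blast
    qed
    have "sorted_wrt ?le ?zs"
      using ys(2) right tr
      by (auto simp: sorted_wrt_append intro: sorted_wrt_filter dest: transD)
    with m show ?case by blast
  qed
  have uniq: "ys = zs" if "mset ys = mset zs" "sorted_wrt ?le ys" "sorted_wrt ?le zs" for ys zs
    using that
  proof (induction ys arbitrary: zs)
    case Nil
    then show ?case by simp
  next
    case (Cons y ys)
    then obtain z zs' where zs: "zs = z # zs'"
      by (cases zs) auto
    have "y \<in> set zs" "z \<in> set (y # ys)"
      using Cons.prems(1) zs by (metis list.set_intros(1) mset_eq_setD)+
    then have "?le y z" "?le z y"
      using Cons.prems(2,3) zs by auto
    then have "y = z" by (rule antisym)
    with Cons zs show ?case by auto
  qed
  show ?thesis using ex uniq by (metis (no_types, lifting))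
qed

lemma conjugates_sort_ex1:
  assumes "linear_order_on A R" "set w \<subseteq> A"
  shows "\<exists>!cs. mset cs = mset (conjugates w) \<and> sorted_wrt (lex_le R) cs"
proof -
  have s: "strict_linear_order_on A (R - Id)"
    using assms(1) by (rule strict_linear_order_on_diff_Id)
  have t: "(u, v) \<in> lexord (R - Id)"
    if "set u \<subseteq> A" "set v \<subseteq> A" "u \<noteq> v" "(v, u) \<notin> lexord (R - Id)" for u v
    using that
  proof (induction u arbitrary: v)
    case Nil
    then show ?case by (cases v) auto
  next
    case (Cons x u)
    then show ?case using s
      by (cases v) (auto simp: strict_linear_order_on_def total_on_def)
  qed
  have "strict_linear_order_on (lists A) (lexord (R - Id))"
    using s t unfolding strict_linear_order_on_def
    by (auto simp: total_on_def in_lists_conv_set subset_iff intro: lexord_transI lexord_irrefl)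
  moreover have "set (conjugates w) \<subseteq> lists A"
    using assms(2) by (auto simp: conjugates_def)
  ultimately show ?thesis
    unfolding lex_le_def by (rule strict_total_sort_ex1)
qed

lemma increasing_listing_ex1:
  assumes "linear_order_on A R" "finite A"
  shows "\<exists>!es. set es = A \<and> sorted_wrt (\<lambda>x y. (x, y) \<in> R - Id) es"
proof -
  let ?S = "R - Id"
  have s: "strict_linear_order_on A ?S"
    using assms(1) by (rule strict_linear_order_on_diff_Id)
  obtain xs where xs: "set xs = A" "distinct xs"
    using finite_distinct_list[OF assms(2)] by blast
  have iff: "set es = A \<and> sorted_wrt (\<lambda>x y. (x, y) \<in> ?S) es \<longleftrightarrow>
      mset es = mset xs \<and> sorted_wrt (\<lambda>u v. u = v \<or> (u, v) \<in> ?S) es" (is "?L \<longleftrightarrow> ?R") for es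
  proof
    assume L: ?L
    have "distinct es"
      using L[THEN conjunct2] by (induction es) auto
    then have "mset es = mset xs"
      using L xs by (metis set_eq_iff_mset_eq_distinct)
    moreover have "sorted_wrt (\<lambda>u v. u = v \<or> (u, v) \<in> ?S) es"
      using L by (auto elim: sorted_wrt_mono_rel[rotated])
    ultimately show ?R by blast
  next
    assume R: ?R
    then have e: "set es = A" "distinct es"
      using xs by (metis mset_eq_setD, metis mset_eq_imp_distinct_iff)
    have "sorted_wrt (\<lambda>x y. (x, y) \<in> ?S) es"
      using R[THEN conjunct2] e(2) by (induction es) auto
    with e show ?L by blast
  qed
  show ?thesis
    unfolding iff using strict_total_sort_ex1[OF s] xs(1) by blast
qed

end

theory Submission
  imports Defs
begin

text \<open>
  If \<open>v\<close> clusters for an order \<open>R\<close> and a permutation \<open>\<pi>\<close>, and \<open>z w t\<close>, \<open>z' w t'\<close> are factors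
  of \<open>v\<close> with \<open>z \<noteq> z'\<close>, \<open>t \<noteq> t'\<close>, then comparing the conjugates that begin with \<open>w t\<close> and
  \<open>w t'\<close> shows that \<open>t\<close> precedes \<open>t'\<close> for \<open>R\<close> exactly when \<open>z\<close> precedes \<open>z'\<close> for the order
  transported by \<open>\<pi>\<close> (\<open>clusters_order_iff\<close>). So a word cannot cluster as soon as its factors
  impose contradictory comparisons.

  In an AR language the word \<open>w_k\<close> can be extended to \<open>x w_k y\<close> only if \<open>x\<close> or \<open>y\<close> is the
  rule at stage \<open>k\<close>. The comparisons around the empty word, whose rule is \<open>a\<close>, make \<open>a\<close> an
  extremal letter among \<open>a, b, c\<close> for \<open>R\<close>, and an extremal letter at the other end for the
  transported order. The word \<open>w_k\<close> at the first rule \<open>b\<close> does the same for \<open>b\<close>, and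
  \<open>w = w_k\<close> for the first rule \<open>c\<close> would then require the same of \<open>c\<close>; three letters cannot
  all be extremal. The factors \<open>c w a\<close>, \<open>a w c\<close> and one of \<open>c w b\<close>, \<open>b w c\<close> suffice for
  this, as they also contain the shorter contexts (\<open>three_rules_never_cluster\<close>).

  These factors occur in every long word because of a simple form of recurrence. If the rule at
  stage \<open>m > k\<close> is \<open>e\<close>, every block of level \<open>m + 1\<close> ends with \<open>A_m^(e)\<close>. Where that suffix
  starts, one reads \<open>e\<close> after \<open>c w_k\<close>; one block of level \<open>k\<close> later, one reads \<open>c\<close> after
  \<open>e w_k\<close>. Such places are separated by the length of one block of level \<open>m + 1\<close>
  (\<open>rule_recurrence\<close>), which gives the general bound.

  For the 4-Bonacci language the same count of positions is made more carefully. A word of length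
  at least 57 contains one of the factors \<open>a3 w a2\<close>, \<open>a2 w a3\<close>, except when it has length
  exactly 57 and fits between two consecutive pairs of them that are as far apart as possible.
  This exceptional word contains \<open>A_5^(a2) A_5^(a3)\<close>, where the contexts of \<open>w_2\<close> and \<open>w_3\<close>
  compare \<open>a3\<close> and \<open>a4\<close> in contradictory ways (\<open>shared_contexts_never_cluster\<close>). Hence 57 is a
  bound, below both 58 and 60, and all the assertions about the 4-Bonacci language follow.
\<close>

section \<open>Clustering forces an order condition\<close>

text \<open>
  The right-hand side in the definition of clustering is weakly increasing for the order that \<open>f\<close>
  transports from the listing.
\<close>

lemma sorted_concat_replicate:
  assumes "sorted_wrt S es" "inj f"
  shows "sorted_wrt (\<lambda>p q. p = q \<or> S (inv f p) (inv f q))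
           (concat (map (\<lambda>e. replicate (n e) (f e)) es))"
proof -
  have "sorted_wrt T (replicate m x)" if "T x x" for T and x :: 'b and m
    using that by (induction m) simp_all
  then show ?thesis
    using assms by (induction es) (auto simp: sorted_wrt_append inv_f_f)
qed

lemma conjugate_at_factor:
  assumes "sublist (z # w @ [t]) v"
  obtains X where "w @ t # X \<in> set (conjugates v)" "last (w @ t # X) = z"
proof -
  obtain P S where v: "v = P @ (z # w @ [t]) @ S"
    using assms by (auto simp: sublist_def)
  have "rotate (length (P @ [z])) ((P @ [z]) @ (w @ t # S)) = (w @ t # S) @ (P @ [z])"
    by (rule rotate_append)
  then have "rotate (Suc (length P)) v = w @ t # (S @ P @ [z])"
    by (simp add: v)
  moreover have "Suc (length P) < length v"
    by (simp add: v)
  ultimately have "w @ t # (S @ P @ [z]) \<in> set (conjugates v)"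
    unfolding conjugates_def by (force simp: image_iff)
  with that show thesis by simp
qed

text \<open>
  The conjugate beginning with \<open>w t\<close> ends with \<open>z\<close>, and the one beginning with \<open>w t'\<close> ends
  with \<open>z'\<close>. The first is lexicographically smaller, so \<open>z\<close> comes before \<open>z'\<close> in the
  Burrows-Wheeler transform, whose letters appear in the transported order.
\<close>

lemma clusters_order_mono:
  assumes lin: "linear_order_on A R" and fin: "finite A" and perm: "\<pi> permutes A"
    and cl: "clusters A R \<pi> v" and sub: "set v \<subseteq> A"
    and f1: "sublist (z # w @ [t]) v" and f2: "sublist (z' # w @ [t']) v"
    and tt: "(t, t') \<in> R" and "t \<noteq> t'" and "z \<noteq> z'"
  shows "(inv \<pi> z, inv \<pi> z') \<in> R"
proof -
  define cs where "cs = (THE cs. mset cs = mset (conjugates v) \<and> sorted_wrt (lex_le R) cs)"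
  have cs: "mset cs = mset (conjugates v)" "sorted_wrt (lex_le R) cs"
    unfolding cs_def using theI'[OF conjugates_sort_ex1[OF lin sub]] by auto
  define es where "es = increasing_listing A R"
  have es: "sorted_wrt (\<lambda>x y. (x, y) \<in> R - Id) es"
    unfolding es_def increasing_listing_def
    using theI'[OF increasing_listing_ex1[OF lin fin]] by auto
  have B: "map last cs = concat (map (\<lambda>e. replicate (count_list v (\<pi> e)) (\<pi> e)) es)"
    using cl unfolding clusters_def BWT_def cs_def es_def .
  obtain X X' where
    C: "w @ t # X \<in> set (conjugates v)" "last (w @ t # X) = z" and
    C': "w @ t' # X' \<in> set (conjugates v)" "last (w @ t' # X') = z'"
    using f1 f2 by (metis conjugate_at_factor)
  have lt: "(w @ t # X, w @ t' # X') \<in> lexord (R - Id)"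
    using tt \<open>t \<noteq> t'\<close> by (auto intro!: lexord_append_leftI)
  have S: "trans (R - Id)" "irrefl (R - Id)"
    using strict_linear_order_on_diff_Id[OF lin] by (auto simp: strict_linear_order_on_def)
  have nle: "\<not> lex_le R (w @ t' # X') (w @ t # X)"
    using lt S lexord_trans[OF _ lt S(1)] lexord_irrefl[OF S(2)] \<open>t \<noteq> t'\<close>
    unfolding lex_le_def irrefl_def by (metis nth_append_length)
  have "set cs = set (conjugates v)"
    using cs(1) by (rule mset_eq_setD)
  then obtain i i' where i: "i < length cs" "cs ! i = w @ t # X"
    and i': "i' < length cs" "cs ! i' = w @ t' # X'"
    using C(1) C'(1) by (metis in_set_conv_nth)
  have "i < i'"
  proof (rule ccontr)
    assume "\<not> i < i'"
    moreover have "i \<noteq> i'" using i i' \<open>t \<noteq> t'\<close> by auto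
    ultimately have "i' < i" by simp
    then show False
      using sorted_wrt_nth_less[OF cs(2) _ i(1)] nle i i' by metis
  qed
  have "sorted_wrt (\<lambda>p q. p = q \<or> (inv \<pi> p, inv \<pi> q) \<in> R - Id) (map last cs)"
    unfolding B using sorted_concat_replicate[OF es permutes_inj[OF perm]] .
  from sorted_wrt_nth_less[OF this \<open>i < i'\<close>] show ?thesis
    using i i' C(2) C'(2) \<open>z \<noteq> z'\<close> by (simp del: last.simps last_append)
qed

lemma clusters_order_iff:
  assumes lin: "linear_order_on A R" and fin: "finite A" and perm: "\<pi> permutes A"
    and cl: "clusters A R \<pi> v" and sub: "set v \<subseteq> A"
    and f1: "sublist (z # w @ [t]) v" and f2: "sublist (z' # w @ [t']) v"
    and "t \<noteq> t'" and "z \<noteq> z'"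
  shows "(inv \<pi> z, inv \<pi> z') \<in> R \<longleftrightarrow> (t, t') \<in> R"
proof -
  have "t \<in> A" "t' \<in> A"
    using set_mono_sublist[OF f1] set_mono_sublist[OF f2] sub by auto
  then have tot: "(t, t') \<in> R \<or> (t', t) \<in> R"
    using lin \<open>t \<noteq> t'\<close> by (auto simp: linear_order_on_def total_on_def)
  have "inv \<pi> z \<noteq> inv \<pi> z'"
    using \<open>z \<noteq> z'\<close> perm by (metis permutes_inverses(1))
  then have anti: "\<not> ((inv \<pi> z, inv \<pi> z') \<in> R \<and> (inv \<pi> z', inv \<pi> z) \<in> R)"
    using lin by (auto simp: linear_order_on_def partial_order_on_def antisym_def)
  show ?thesis
    using clusters_order_mono[OF lin fin perm cl sub f1 f2 _ assms(8,9)]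
      clusters_order_mono[OF lin fin perm cl sub f2 f1 _ assms(8,9)[symmetric]] tot anti
    by blast
qed

section \<open>Blocks and the words between them\<close>

text \<open>
  This is the image of \<open>u\<close> under the composition of the substitutions of the first \<open>k\<close> rules; each
  letter of \<open>u\<close> names the block of level \<open>k\<close> that it produces.
\<close>

definition AR_blocks :: "(nat \<Rightarrow> 'a) \<Rightarrow> nat \<Rightarrow> 'a list \<Rightarrow> 'a list" where
  "AR_blocks d k u = concat (map (AR_word d k) u)"

lemma AR_blocks_simps [simp]:
  "AR_blocks d k [] = []"
  "AR_blocks d k (j # u) = AR_word d k j @ AR_blocks d k u"
  "AR_blocks d k (u @ u') = AR_blocks d k u @ AR_blocks d k u'"
  by (simp_all add: AR_blocks_def)

lemma AR_word_nonempty [simp]: "AR_word d k j \<noteq> []"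
  by (induction k) auto

text \<open>
  The rule at stage \<open>k\<close> appends a block of \<open>d k\<close> to every other block, so every block of the next
  level ends with one.
\<close>

lemma AR_blocks_Suc: "\<exists>r'. AR_blocks d (Suc k) r = AR_blocks d k r' \<and> (r \<noteq> [] \<longrightarrow> r' \<noteq> [] \<and> last r' = d k)"
proof -
  let ?r' = "concat (map (\<lambda>j. if j = d k then [j] else [j, d k]) r)"
  have "AR_blocks d (Suc k) r = AR_blocks d k ?r'"
    by (induction r) auto
  moreover have "r \<noteq> [] \<longrightarrow> ?r' \<noteq> [] \<and> last ?r' = d k"
    by (induction r) auto
  ultimately show ?thesis by blast
qed

lemma AR_blocks_refine:
  assumes "k \<le> m"
  shows "\<exists>r'. AR_blocks d m r = AR_blocks d k r'"
  using assms
proof (induction m arbitrary: r rule: dec_induct)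
  case (step m)
  then show ?case using AR_blocks_Suc by metis
qed auto

lemma AR_blocks_last_rule:
  assumes "k < m" "r \<noteq> []"
  shows "\<exists>r'. AR_blocks d m r = AR_blocks d k (r' @ [d k])"
proof -
  obtain r1 where r1: "AR_blocks d m r = AR_blocks d (Suc k) r1"
    using AR_blocks_refine[of "Suc k" m d r] assms(1) by auto
  have "AR_blocks d m r \<noteq> []"
    using assms(2) by (cases r) auto
  then have "r1 \<noteq> []" using r1 by auto
  then obtain r2 where "AR_blocks d (Suc k) r1 = AR_blocks d k r2" "r2 \<noteq> []" "last r2 = d k"
    using AR_blocks_Suc by metis
  then show ?thesis
    using r1 by (metis append_butlast_last_id)
qed

lemma AR_word_prefix_mono:
  assumes "k \<le> m"
  shows "prefix (AR_word d k j) (AR_word d m j)"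
  using assms
proof (induction m rule: dec_induct)
  case (step m)
  then show ?case by (auto intro: prefix_prefix)
qed simp

lemma AR_word_start: "\<exists>T. AR_word d k j = j # T"
  using AR_word_prefix_mono[of 0 k d j] by (auto simp: prefix_def)

text \<open>
  Reading a block after \<open>w_k\<close> reproduces \<open>w_k\<close> at the end, preceded by the name of the block. Hence
  \<open>w_k\<close> stands before each boundary between blocks of level \<open>k\<close>; the letter after it names the block
  that starts there, and the letter before it names the block that has just ended.
\<close>

lemma AR_w_word: "\<exists>g. AR_w d k @ AR_word d k x = g @ x # AR_w d k"
proof (induction k arbitrary: x)
  case (Suc k)
  obtain g where g: "AR_w d k @ AR_word d k (d k) = g @ d k # AR_w d k"
    using Suc by blast
  obtain h where h: "AR_w d k @ AR_word d k x = h @ x # AR_w d k"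
    using Suc by blast
  show ?case
  proof (cases "x = d k")
    case True
    have "AR_w d (Suc k) @ AR_word d (Suc k) x
        = (AR_w d k @ AR_word d k (d k)) @ AR_word d k (d k)"
      using True by simp
    also have "\<dots> = g @ x # AR_w d (Suc k)"
      unfolding g using True by simp
    finally show ?thesis by blast
  next
    case False
    have "AR_w d (Suc k) @ AR_word d (Suc k) x
        = (AR_w d k @ AR_word d k (d k)) @ AR_word d k x @ AR_word d k (d k)"
      using False by simp
    also have "\<dots> = (g @ [d k]) @ (AR_w d k @ AR_word d k x) @ AR_word d k (d k)"
      unfolding g by simp
    also have "\<dots> = (g @ [d k] @ h) @ x # AR_w d (Suc k)"
      unfolding h by simp
    finally show ?thesis by blast
  qed
qed simp

lemma AR_w_blocks_suffix: "suffix (AR_w d k) (AR_w d k @ AR_blocks d k r)"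
proof (induction r rule: rev_induct)
  case (snoc x r)
  then obtain h where h: "AR_w d k @ AR_blocks d k r = h @ AR_w d k"
    by (auto simp: suffix_def)
  obtain g where g: "AR_w d k @ AR_word d k x = g @ x # AR_w d k"
    using AR_w_word by metis
  have "AR_w d k @ AR_blocks d k (r @ [x]) = h @ AR_w d k @ AR_word d k x"
    using h by simp
  also have "\<dots> = (h @ g @ [x]) @ AR_w d k"
    unfolding g by simp
  finally show ?case by (auto simp: suffix_def)
qed simp

lemma AR_w_left_extension: "suffix (x # AR_w d k) (AR_w d k @ AR_blocks d k (r @ [x]))"
proof -
  obtain h where h: "AR_w d k @ AR_blocks d k r = h @ AR_w d k"
    using AR_w_blocks_suffix by (metis suffixE)
  obtain g where g: "AR_w d k @ AR_word d k x = g @ x # AR_w d k"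
    using AR_w_word by metis
  have "AR_w d k @ AR_blocks d k (r @ [x]) = h @ AR_w d k @ AR_word d k x"
    using h by simp
  also have "\<dots> = (h @ g) @ x # AR_w d k"
    unfolding g by simp
  finally show ?thesis by (auto simp: suffix_def)
qed

lemma AR_w_mono:
  assumes "k \<le> m"
  shows "prefix (AR_w d k) (AR_w d m)" "suffix (AR_w d k) (AR_w d m)"
proof -
  have "\<exists>r. AR_w d m = AR_w d k @ AR_blocks d k r"
    using assms
  proof (induction m rule: dec_induct)
    case base
    then show ?case by (metis AR_blocks_simps(1) append_Nil2)
  next
    case (step m)
    obtain r where r: "AR_w d m = AR_w d k @ AR_blocks d k r" using step by blast
    obtain r' where "AR_blocks d m [d m] = AR_blocks d k r'"
      using AR_blocks_refine step.hyps(1) by blast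
    then have "AR_w d (Suc m) = AR_w d k @ AR_blocks d k (r @ r')"
      using r by simp
    then show ?case by blast
  qed
  then obtain r where r: "AR_w d m = AR_w d k @ AR_blocks d k r" by blast
  show "prefix (AR_w d k) (AR_w d m)" "suffix (AR_w d k) (AR_w d m)"
    unfolding r by (rule prefixI[OF refl], rule AR_w_blocks_suffix)
qed

lemma factor_in_window:
  assumes Z: "P @ v @ S = X @ m @ T"
    and lo: "length P \<le> length X" and hi: "length (X @ m) \<le> length (P @ v)"
  shows "sublist m v"
proof -
  obtain X' where X: "X = P @ X'"
    using Z lo by (metis append_eq_append_conv_if append_eq_conv_conj append_take_drop_id)
  then have "v @ S = (X' @ m) @ T"
    using Z by simp
  moreover have "length (X' @ m) \<le> length v"
    using hi X by simp
  ultimately obtain T' where "v = (X' @ m) @ T'"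
    by (metis append_eq_append_conv_if append_eq_conv_conj append_take_drop_id)
  then show ?thesis by (auto simp: sublist_def)
qed

text \<open>
  Prepending \<open>w\<close> to the left of the whole word only supplies a context to positions too close to its
  beginning; from position \<open>length w + 1\<close> of the window on, the context already lies inside \<open>v\<close>.
\<close>

lemma context_in_window:
  assumes Z: "P @ v @ S = X @ y # T" and suf: "suffix (x # w) (w @ X)"
    and lo: "length P + length w + 1 \<le> length X" and hi: "length X < length P + length v"
  shows "sublist (x # w @ [y]) v"
proof -
  have "suffix (x # w) X"
    using suf lo suffix_length_suffix[of "x # w" "w @ X" X] by (simp add: suffix_def)
  then obtain Q where Q: "X = Q @ x # w" by (auto simp: suffix_def)
  show ?thesis
    by (rule factor_in_window[of P v S Q _ T]) (use Z lo hi Q in auto)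
qed

text \<open>
  The level \<open>m\<close> can be arbitrary, because \<open>A_k^(i)\<close> is a prefix of \<open>A_(m+k)^(i)\<close>.
\<close>

lemma AR_language_blocks:
  assumes v: "v \<in> AR_language A d" and rg: "range d \<subseteq> A"
  obtains u P S where "set u \<subseteq> A" "AR_blocks d m u = P @ v @ S"
proof -
  obtain k i where "i \<in> A" and sub: "sublist v (AR_word d k i)"
    using v by (auto simp: AR_language_def)
  have *: "\<exists>u. set u \<subseteq> A \<and> AR_blocks d m u = AR_word d (m + n) i" for n
  proof -
    have "\<forall>i\<in>A. \<exists>u. set u \<subseteq> A \<and> AR_blocks d m u = AR_word d (m + n) i"
    proof (induction n)
      case 0
      have "set [i] \<subseteq> A \<and> AR_blocks d m [i] = AR_word d (m + 0) i" if "i \<in> A" for i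
        using that by simp
      then show ?case by blast
    next
      case (Suc n)
      show ?case
      proof
        fix i assume "i \<in> A"
        have "d (m + n) \<in> A" using rg by auto
        then obtain u u' where "set u \<subseteq> A" "AR_blocks d m u = AR_word d (m + n) i"
          "set u' \<subseteq> A" "AR_blocks d m u' = AR_word d (m + n) (d (m + n))"
          using Suc \<open>i \<in> A\<close> by blast
        then show "\<exists>u. set u \<subseteq> A \<and> AR_blocks d m u = AR_word d (m + Suc n) i"
          by (intro exI[of _ "if i = d (m + n) then u else u @ u'"]) auto
      qed
    qed
    then show ?thesis using \<open>i \<in> A\<close> by blast
  qed
  obtain u where u: "set u \<subseteq> A" "AR_blocks d m u = AR_word d (m + k) i"
    using * by blast
  have "sublist v (AR_word d (m + k) i)"
    using sublist_order.order_trans[OF sub prefix_imp_sublist[OF AR_word_prefix_mono]] by simp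
  with u that show thesis by (auto simp: sublist_def)
qed

lemma set_AR_word: "set (AR_word d k i) \<subseteq> insert i (range d)"
  by (induction k arbitrary: i) auto

lemma AR_language_letters:
  assumes "v \<in> AR_language A d" "range d \<subseteq> A"
  shows "set v \<subseteq> A"
proof -
  obtain k i where "i \<in> A" "sublist v (AR_word d k i)"
    using assms(1) by (auto simp: AR_language_def)
  then show ?thesis
    using set_mono_sublist[of v "AR_word d k i"] set_AR_word[of d k i] assms(2) by blast
qed

lemma AR_word_length_mono: "k \<le> m \<Longrightarrow> length (AR_word d k i) \<le> length (AR_word d m i)"
  by (simp add: AR_word_prefix_mono prefix_length_le)

section \<open>Recurrence of a rule\<close>

text \<open>
  The conclusion keeps the information that the previous prefix falls short, which bounds by how much
  the threshold is exceeded. For a monotone length, the found prefix is the first one to reach it.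
\<close>

lemma first_prefix_reaching:
  assumes "(f :: 'b list \<Rightarrow> nat) u \<ge> N" "u \<noteq> []"
  shows "\<exists>u1 j u2. u = u1 @ j # u2 \<and> N \<le> f (u1 @ [j]) \<and> (u1 = [] \<or> f u1 < N)"
  using assms
proof (induction u rule: rev_induct)
  case (snoc j u)
  show ?case
  proof (cases "u = [] \<or> f u < N")
    case True
    then show ?thesis using snoc.prems by blast
  next
    case False
    then obtain u1 i u2 where "u = u1 @ i # u2" "N \<le> f (u1 @ [i])" "u1 = [] \<or> f u1 < N"
      using snoc.IH by auto
    then have "u @ [j] = u1 @ i # (u2 @ [j])" by simp
    then show ?thesis using \<open>N \<le> f (u1 @ [i])\<close> \<open>u1 = [] \<or> f u1 < N\<close> by blast
  qed
qed simp

lemma AR_blocks_ending: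
  obtains r where "AR_blocks d (Suc m) (u @ [j]) = AR_blocks d m r @ AR_word d m (d m)"
proof -
  obtain r where r: "AR_blocks d (Suc m) (u @ [j]) = AR_blocks d m r" "r \<noteq> []" "last r = d m"
    using AR_blocks_Suc[of d m "u @ [j]"] by auto
  then have "AR_blocks d m r = AR_blocks d m (butlast r @ [d m])"
    using append_butlast_last_id by metis
  then show thesis
    using r(1) that[of "butlast r"] by (metis AR_blocks_simps append_Nil2)
qed

text \<open>
  The number \<open>q\<close> is the position at which the final \<open>A_m^(d m)\<close> of a block of level \<open>m + 1\<close> starts.
  What precedes it is a concatenation of blocks of level \<open>m\<close>, all ending with the block of \<open>d k\<close> of
  level \<open>k\<close>, and it starts itself with the blocks of \<open>d m\<close> and \<open>d k\<close> of level \<open>k\<close>. This gives the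
  two contexts of \<open>w_k\<close>, ending at \<open>q\<close> and one block of level \<open>k\<close> later.
\<close>

lemma rule_occurrence:
  assumes km: "k < m" and ne: "d m \<noteq> d k"
    and eq: "P @ v @ S = AR_blocks d (Suc m) (u1 @ j # u2)"
  defines "q \<equiv> length (AR_blocks d (Suc m) (u1 @ [j])) - length (AR_word d m (d m))"
  shows "length P + length (AR_w d k) + 1 \<le> q \<Longrightarrow> q < length P + length v
      \<Longrightarrow> sublist (d k # AR_w d k @ [d m]) v"
    and "length P + length (AR_w d k) + 1 \<le> q + length (AR_word d k (d m))
      \<Longrightarrow> q + length (AR_word d k (d m)) < length P + length v
      \<Longrightarrow> sublist (d m # AR_w d k @ [d k]) v"
proof -
  obtain r where r: "AR_blocks d (Suc m) (u1 @ [j]) = AR_blocks d m r @ AR_word d m (d m)"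
    by (rule AR_blocks_ending)
  have q: "q = length (AR_blocks d m r)"
    unfolding q_def r by simp
  have Z: "P @ v @ S = AR_blocks d m r @ AR_word d m (d m) @ AR_blocks d (Suc m) u2"
    unfolding eq using r by simp
  {
    assume lo: "length P + length (AR_w d k) + 1 \<le> q" and hi: "q < length P + length v"
    have "r \<noteq> []" using lo q by auto
    then obtain r' where r': "AR_blocks d m r = AR_blocks d k (r' @ [d k])"
      using AR_blocks_last_rule[OF km] by blast
    obtain T where "AR_word d m (d m) = d m # T" using AR_word_start by metis
    then have "P @ v @ S = AR_blocks d m r @ d m # (T @ AR_blocks d (Suc m) u2)"
      using Z by simp
    moreover have "suffix (d k # AR_w d k) (AR_w d k @ AR_blocks d m r)"
      unfolding r' by (rule AR_w_left_extension)
    ultimately show "sublist (d k # AR_w d k @ [d m]) v"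
      by (rule context_in_window) (use lo hi q in auto)
  }
  {
    assume lo: "length P + length (AR_w d k) + 1 \<le> q + length (AR_word d k (d m))"
      and hi: "q + length (AR_word d k (d m)) < length P + length v"
    obtain r' where r': "AR_blocks d m r = AR_blocks d k r'"
      using AR_blocks_refine[of k m d r] km by auto
    have "prefix (AR_word d (Suc k) (d m)) (AR_word d m (d m))"
      using km by (intro AR_word_prefix_mono) simp
    then obtain T1 where T1: "AR_word d m (d m) = AR_word d k (d m) @ AR_word d k (d k) @ T1"
      using ne by (auto simp: prefix_def)
    obtain T2 where T2: "AR_word d k (d k) = d k # T2" using AR_word_start by metis
    have "P @ v @ S = AR_blocks d k (r' @ [d m]) @ d k # (T2 @ T1 @ AR_blocks d (Suc m) u2)"
      using Z T1 T2 r' by simp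
    moreover have "suffix (d m # AR_w d k) (AR_w d k @ AR_blocks d k (r' @ [d m]))"
      by (rule AR_w_left_extension)
    ultimately show "sublist (d m # AR_w d k @ [d k]) v"
      by (rule context_in_window) (use lo hi q r' in auto)
  }
qed

text \<open>
  The positions of \<open>rule_occurrence\<close> differ by block lengths, hence by at most \<open>L\<close>, and one of
  them meets the \<open>L\<close> last positions of \<open>v\<close>, each of which has a context of length
  \<open>length (AR_w d k) + 1\<close> to its left inside \<open>v\<close>.
\<close>

lemma rule_recurrence:
  assumes v: "v \<in> AR_language A d" and rg: "range d \<subseteq> A"
    and km: "k < m" and ne: "d m \<noteq> d k"
    and L: "\<And>i. i \<in> A \<Longrightarrow> length (AR_word d (Suc m) i) \<le> L"
    and len: "length (AR_w d k) + L + 1 \<le> length v"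
  shows "sublist (d k # AR_w d k @ [d m]) v" "sublist (d m # AR_w d k @ [d k]) v"
proof -
  obtain u P S where u: "set u \<subseteq> A" and eq: "AR_blocks d (Suc m) u = P @ v @ S"
    using v rg by (rule AR_language_blocks)
  let ?f = "\<lambda>u. length (AR_blocks d (Suc m) u)"
  let ?s = "length (AR_word d m (d m))"
  have sL: "?s \<le> L"
    using L[of "d m"] rg by auto
  have une: "u \<noteq> []" using eq len by auto
  have fu: "?f u = length P + length v + length S" using eq by simp
  \<comment> \<open>The two contexts end at offsets \<open>0\<close> and \<open>length (AR_word d k (d m))\<close> from the start of the
    final \<open>A_m^(d m)\<close>; both are found by the same argument, for an offset \<open>h\<close> of at most \<open>?s\<close>.\<close>
  have window: "\<exists>u1 j u2. u = u1 @ j # u2 \<and> length P + length (AR_w d k) + 1 \<le> ?f (u1 @ [j]) - ?s + h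
      \<and> ?f (u1 @ [j]) - ?s + h < length P + length v" if h: "h \<le> ?s" for h
  proof -
    let ?N = "length P + length (AR_w d k) + 1 + ?s - h"
    have "?N \<le> ?f u" using fu len sL by linarith
    from first_prefix_reaching[of ?N ?f, OF this une]
    obtain u1 j u2 where dec: "u = u1 @ j # u2" and N: "?N \<le> ?f (u1 @ [j])"
      and first: "u1 = [] \<or> ?f u1 < ?N" by blast
    have "j \<in> A" using dec u by auto
    then have "?f (u1 @ [j]) \<le> ?f u1 + L" using L by simp
    moreover have "?f u1 < ?N" using first h by auto
    moreover obtain r where "AR_blocks d (Suc m) (u1 @ [j]) = AR_blocks d m r @ AR_word d m (d m)"
      by (rule AR_blocks_ending)
    then have "?s \<le> ?f (u1 @ [j])" by simp
    ultimately have "?f (u1 @ [j]) - ?s + h < length P + length v"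
      using len h N by linarith
    moreover have "length P + length (AR_w d k) + 1 \<le> ?f (u1 @ [j]) - ?s + h"
      using N h \<open>?s \<le> ?f (u1 @ [j])\<close> by linarith
    ultimately show ?thesis using dec by blast
  qed
  show "sublist (d k # AR_w d k @ [d m]) v"
    using window[of 0] rule_occurrence(1)[OF km ne] eq by (metis add_0_right le0)
  have "length (AR_word d k (d m)) \<le> ?s"
    using km by (simp add: AR_word_length_mono)
  then show "sublist (d m # AR_w d k @ [d k]) v"
    using window rule_occurrence(2)[OF km ne] eq by metis
qed


section \<open>Three rules contradict the order condition\<close>

lemma AR_w_constant_rules:
  assumes "\<And>k. k < n \<Longrightarrow> d k = a"
  shows "AR_w d n = replicate n a" "AR_word d n j = (if j = a then [a] else j # replicate n a)"
proof -
  have "AR_w d n = replicate n a \<and> (\<forall>j. AR_word d n j = (if j = a then [a] else j # replicate n a))"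
    using assms
  proof (induction n)
    case (Suc n)
    then have IH: "AR_w d n = replicate n a"
      "AR_word d n j = (if j = a then [a] else j # replicate n a)" for j
      by simp_all
    have "d n = a" using Suc.prems by simp
    then show ?case
      by (simp add: IH replicate_append_same)
  qed simp
  then show "AR_w d n = replicate n a"
    "AR_word d n j = (if j = a then [a] else j # replicate n a)" by auto
qed

text \<open>
  Before the first rule \<open>b\<close> there are \<open>n\<close> rules \<open>a\<close>, so the word \<open>w\<close> of the next stage is
  \<open>a^n b a^n\<close>. All later ones begin and end with it, so a context of \<open>w\<close> at the first rule \<open>c\<close> also
  contains contexts of \<open>a^n\<close>, the word at the first rule \<open>b\<close>.
\<close>

lemma rule_letters:
  assumes dir: "AR_directive A d" and "finite A" "3 \<le> card A"
  shows "rule_a d \<noteq> rule_b d" "d (lambda2 d) \<notin> {rule_a d, rule_b d}"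
    "rule_a d \<in> A" "rule_b d \<in> A" "d (lambda2 d) \<in> A"
    and "\<exists>n. 0 < n \<and> prefix (replicate n (rule_a d) @ [rule_b d]) (AR_w d (lambda2 d))
            \<and> suffix (rule_b d # replicate n (rule_a d)) (AR_w d (lambda2 d))"
proof -
  have occurs: "\<exists>k. d k = i" if "i \<in> A" for i
    proof -
    have "infinite {k. d k = i}" using dir that by (simp add: AR_directive_def)
    then have "{k. d k = i} \<noteq> {}" by (metis finite.emptyI)
    then show ?thesis by simp
  qed
  have fresh: "\<exists>k. d k \<notin> B" if "card B < 3" "finite B" for B
  proof -
    have "\<not> A \<subseteq> B" using card_mono[OF that(2), of A] that(1) assms(3) by linarith
    then show ?thesis using occurs by blast
  qed
  define n where "n = (LEAST k. d k \<noteq> rule_a d)"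
  have "\<exists>k. d k \<notin> {rule_a d}" by (rule fresh) auto
  then have dn: "d n \<noteq> rule_a d" unfolding n_def using LeastI_ex[of "\<lambda>k. d k \<noteq> rule_a d"] by simp
  have b: "rule_b d = d n" by (simp add: rule_b_def n_def)
  show ab: "rule_a d \<noteq> rule_b d" using dn b by simp
  have "\<exists>k. d k \<notin> {rule_a d, rule_b d}"
    by (rule fresh) (simp_all add: card_insert_if)
  then show c: "d (lambda2 d) \<notin> {rule_a d, rule_b d}"
    unfolding lambda2_def using LeastI_ex[of "\<lambda>k. d k \<notin> {rule_a d, rule_b d}"] by blast
  show "rule_a d \<in> A" "rule_b d \<in> A" "d (lambda2 d) \<in> A"
    using dir by (auto simp: AR_directive_def rule_a_def rule_b_def)
  have before: "d k = rule_a d" if "k < n" for k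
    using not_less_Least[of k "\<lambda>k. d k \<noteq> rule_a d"] that by (auto simp: n_def)
  have "0 < n" using dn by (auto simp: rule_a_def intro: gr0I)
  have "n \<le> lambda2 d" unfolding n_def using c by (auto intro: Least_le)
  moreover have "n \<noteq> lambda2 d" using c b by auto
  ultimately have "Suc n \<le> lambda2 d" by simp
  have "AR_w d (Suc n) = replicate n (rule_a d) @ rule_b d # replicate n (rule_a d)"
    using AR_w_constant_rules[of n d "rule_a d"] before dn b by simp
  then have "prefix (replicate n (rule_a d) @ [rule_b d]) (AR_w d (Suc n))"
    "suffix (rule_b d # replicate n (rule_a d)) (AR_w d (Suc n))"
    by (auto simp: suffix_def)
  with AR_w_mono[OF \<open>Suc n \<le> lambda2 d\<close>] \<open>0 < n\<close>
  show "\<exists>n. 0 < n \<and> prefix (replicate n (rule_a d) @ [rule_b d]) (AR_w d (lambda2 d))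
            \<and> suffix (rule_b d # replicate n (rule_a d)) (AR_w d (lambda2 d))"
    by (meson prefix_order.trans suffix_order.trans)
qed

lemma sublist_subwords:
  assumes "sublist (z # w @ [t]) v"
  shows "prefix (p @ [s]) w \<Longrightarrow> sublist (z # p @ [s]) v"
    and "suffix (s # p) w \<Longrightarrow> sublist (s # p @ [t]) v"
proof -
  show "sublist (z # p @ [s]) v" if "prefix (p @ [s]) w"
  proof -
    have "prefix (z # p @ [s]) (z # w @ [t])" using that by (auto simp: prefix_def)
    then show ?thesis using assms prefix_imp_sublist sublist_order.order_trans by blast
  qed
  show "sublist (s # p @ [t]) v" if "suffix (s # p) w"
  proof -
    have "suffix (s # p @ [t]) (z # w @ [t])" using that by (auto simp: suffix_def)
    then show ?thesis using assms suffix_imp_sublist sublist_order.order_trans by blast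
  qed
qed

text \<open>
  The contexts of the empty word and of \<open>a^n\<close> are read off inside \<open>c w a\<close> and \<open>a w c\<close>. The former
  force \<open>b\<close> and \<open>c\<close> to lie on the same side of \<open>a\<close>, the latter force \<open>a\<close> and \<open>c\<close> to lie on the same
  side of \<open>b\<close>, with the sides exchanged by the transport. So \<open>c\<close> lies between \<open>a\<close> and \<open>b\<close>, in
  opposite directions for the two orders, which the contexts of \<open>w\<close> contradict.
\<close>

lemma three_rules_never_cluster:
  assumes dir: "AR_directive A d" and fin: "finite A" and card: "3 \<le> card A"
    and v: "set v \<subseteq> A"
  defines "a \<equiv> rule_a d" and "b \<equiv> rule_b d" and "c \<equiv> d (lambda2 d)" and "w \<equiv> AR_w d (lambda2 d)"
  assumes cwa: "sublist (c # w @ [a]) v" and awc: "sublist (a # w @ [c]) v"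
    and cb: "sublist (c # w @ [b]) v \<or> sublist (b # w @ [c]) v"
  shows "never_clusters A v"
  unfolding never_clusters_def
proof (intro allI impI notI)
  fix R \<pi> assume "linear_order_on A R \<and> \<pi> permutes A \<and> \<pi> \<noteq> id" and cl: "clusters A R \<pi> v"
  then have lin: "linear_order_on A R" and perm: "\<pi> permutes A" by auto
  note letters = rule_letters[OF dir fin card, folded a_def b_def c_def w_def]
  have ne: "a \<noteq> b" "b \<noteq> a" "a \<noteq> c" "c \<noteq> a" "b \<noteq> c" "c \<noteq> b" using letters by auto
  obtain n where n: "0 < n" and pre: "prefix (replicate n a @ [b]) w"
    and suf: "suffix (b # replicate n a) w"
    using letters(6) by blast
  obtain n' where n': "n = Suc n'" using n by (cases n) auto
  note ord = clusters_order_iff[OF lin fin perm cl v]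
  have flip: "(s, t) \<in> R \<longleftrightarrow> (t, s) \<notin> R" if "s \<in> A" "t \<in> A" "s \<noteq> t" for s t
    using lin that unfolding linear_order_on_def partial_order_on_def total_on_def antisym_def
    by blast
  have cb_: "sublist (c # replicate n a @ [b]) v"
    using sublist_subwords(1)[OF cwa pre] .
  have ba_: "sublist (b # replicate n a @ [a]) v"
    using sublist_subwords(2)[OF cwa suf] .
  have bc_: "sublist (b # replicate n a @ [c]) v"
    using sublist_subwords(2)[OF awc suf] .
  have snoc_rep: "replicate n a = replicate n' a @ [a]"
    using n' by (simp add: replicate_append_same)
  have two: "sublist ([] @ [s] @ [t]) v" if "sublist (p @ [s] @ [t] @ q) v" for p q s t
  proof -
    have "sublist ([s] @ [t]) (p @ ([s] @ [t]) @ q)" by (rule sublist_appendI)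
    then show ?thesis using sublist_order.order_trans[OF _ that] by simp
  qed
  have "sublist (c # [] @ [a]) v"
    using two[of "[]" c a "replicate n' a @ [b]"] cb_ n' by simp
  moreover have "sublist (a # [] @ [b]) v"
    using two[of "c # replicate n' a" a b "[]"] cb_ snoc_rep by simp
  moreover have "sublist (a # [] @ [c]) v"
    using two[of "b # replicate n' a" a c "[]"] bc_ snoc_rep by simp
  note empty = calculation this
  have "inv \<pi> s \<in> A" if "s \<in> A" for s
    using permutes_in_image[OF permutes_inv[OF perm]] that by blast
  moreover have "inv \<pi> s \<noteq> inv \<pi> t" if "s \<noteq> t" for s t
    using that perm by (metis permutes_inverses(1))
  ultimately have flip': "(inv \<pi> s, inv \<pi> t) \<in> R \<longleftrightarrow> (inv \<pi> t, inv \<pi> s) \<notin> R"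
    if "s \<in> A" "t \<in> A" "s \<noteq> t" for s t
    using that flip by blast
  have e1: "(inv \<pi> c, inv \<pi> a) \<in> R \<longleftrightarrow> (a, b) \<in> R"
    using ord[OF empty(1) empty(2)] ne by simp
  have e2: "(inv \<pi> c, inv \<pi> a) \<in> R \<longleftrightarrow> (a, c) \<in> R"
    using ord[OF empty(1) empty(3)] ne by simp
  have b1: "(inv \<pi> c, inv \<pi> b) \<in> R \<longleftrightarrow> (b, a) \<in> R"
    using ord[OF cb_ ba_] ne by simp
  have b2: "(inv \<pi> c, inv \<pi> b) \<in> R \<longleftrightarrow> (b, c) \<in> R"
    using ord[OF cb_ bc_] ne by simp
  from cb show False
  proof
    assume "sublist (c # w @ [b]) v"
    then have "(inv \<pi> c, inv \<pi> a) \<in> R \<longleftrightarrow> (b, c) \<in> R"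
      using ord[OF _ awc] ne by simp
    then show False
      using e1 b1 b2 flip[of a b] letters ne by blast
  next
    assume "sublist (b # w @ [c]) v"
    then have "(inv \<pi> c, inv \<pi> b) \<in> R \<longleftrightarrow> (a, c) \<in> R"
      using ord[OF cwa] ne by simp
    then show False
      using e1 e2 b1 flip[of a b] letters ne by blast
  qed
qed

lemma mu_first:
  assumes "AR_directive A d" "e \<in> A"
  shows "lambda2 d < mu_first d e" "d (mu_first d e) = e"
proof -
  have "infinite {k. d k = e}"
    using assms by (simp add: AR_directive_def)
  then have "\<not> {k. d k = e} \<subseteq> {..lambda2 d}"
    using finite_subset by blast
  then have "\<exists>k. lambda2 d < k \<and> d k = e"
    by (auto simp: not_le)
  then have "lambda2 d < mu_first d e \<and> d (mu_first d e) = e"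
    unfolding mu_first_def using LeastI_ex[of "\<lambda>k. lambda2 d < k \<and> d k = e"] by blast
  then show "lambda2 d < mu_first d e" "d (mu_first d e) = e" by auto
qed

lemma long_words_never_cluster:
  assumes fin: "finite A" and card: "3 \<le> card A" and dir: "AR_directive A d"
    and xy: "{x, y} = {rule_a d, rule_b d}" and mu: "mu_first d x < mu_first d y"
    and v: "v \<in> AR_language A d"
    and len: "length (AR_w d (lambda2 d)) + AR_maxlen A d (mu_first d y + 1) + 1 \<le> length v"
  shows "never_clusters A v"
proof -
  let ?L = "AR_maxlen A d (mu_first d y + 1)"
  let ?c = "d (lambda2 d)" and ?w = "AR_w d (lambda2 d)"
  note letters = rule_letters[OF dir fin card]
  have rg: "range d \<subseteq> A" using dir by (simp add: AR_directive_def)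
  have "sublist (?c # ?w @ [e]) v \<and> sublist (e # ?w @ [?c]) v" if "e \<in> {rule_a d, rule_b d}" for e
  proof -
    have "e \<in> A" "e \<noteq> ?c"
      using that letters(2-4) by auto
    then have e: "lambda2 d < mu_first d e" "d (mu_first d e) = e" "e \<noteq> ?c"
      using mu_first[OF dir] by simp_all
    have "mu_first d e \<le> mu_first d y" using that mu unfolding xy[symmetric] by auto
    then have L: "length (AR_word d (Suc (mu_first d e)) i) \<le> ?L" if "i \<in> A" for i
    proof -
      have "length (AR_word d (Suc (mu_first d e)) i) \<le> length (AR_word d (mu_first d y + 1) i)"
        by (rule AR_word_length_mono) (use \<open>mu_first d e \<le> mu_first d y\<close> in simp)
      also have "\<dots> \<le> ?L"
        unfolding AR_maxlen_def using fin that by (intro Max_ge) auto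
      finally show ?thesis .
    qed
    show ?thesis
      using rule_recurrence[OF v rg e(1) _ L len] e(2,3) by metis
  qed
  then show ?thesis
    using three_rules_never_cluster[OF dir fin card AR_language_letters[OF v rg]] by blast
qed


section \<open>The 4-Bonacci language\<close>

text \<open>
  The contexts of the empty word put \<open>r\<close> and \<open>s\<close> on the same side of \<open>p\<close>. Then \<open>w\<close> and \<open>w'\<close>, in
  which \<open>r\<close> and \<open>s\<close> exchange their roles, give opposite answers on how the transported order compares
  \<open>r\<close> with \<open>s\<close>.
\<close>

lemma shared_contexts_never_cluster:
  assumes fin: "finite A" and v: "set v \<subseteq> A" and "distinct [p, q, r, s]"
    and "sublist [p, r] v" "sublist [p, s] v" "sublist [q, p] v"
    and w: "sublist (s # w @ [r]) v" "sublist (r # w @ [p]) v"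
    and w': "sublist (r # w' @ [s]) v" "sublist (s # w' @ [p]) v"
  shows "never_clusters A v"
  unfolding never_clusters_def
proof (intro allI impI notI)
  fix R \<pi> assume "linear_order_on A R \<and> \<pi> permutes A \<and> \<pi> \<noteq> id" and cl: "clusters A R \<pi> v"
  then have lin: "linear_order_on A R" and perm: "\<pi> permutes A" by auto
  note ord = clusters_order_iff[OF lin fin perm cl v]
  have "s \<in> A" "r \<in> A"
    using set_mono_sublist[OF w(1)] v by auto
  then have "inv \<pi> s \<in> A" "inv \<pi> r \<in> A"
    using permutes_in_image[OF permutes_inv[OF perm]] by blast+
  moreover have "inv \<pi> s \<noteq> inv \<pi> r"
    using assms(3) perm permutes_inverses(1) by (metis distinct_length_2_or_more)
  ultimately have flip: "(inv \<pi> s, inv \<pi> r) \<in> R \<longleftrightarrow> (inv \<pi> r, inv \<pi> s) \<notin> R"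
    using lin unfolding linear_order_on_def partial_order_on_def total_on_def antisym_def
    by blast
  have "(inv \<pi> p, inv \<pi> q) \<in> R \<longleftrightarrow> (r, p) \<in> R"
    using ord[of p "[]" r q p] assms(3-6) by auto
  moreover have "(inv \<pi> p, inv \<pi> q) \<in> R \<longleftrightarrow> (s, p) \<in> R"
    using ord[of p "[]" s q p] assms(3-6) by auto
  moreover have "(inv \<pi> s, inv \<pi> r) \<in> R \<longleftrightarrow> (r, p) \<in> R"
    using ord[OF w] assms(3) by auto
  moreover have "(inv \<pi> r, inv \<pi> s) \<in> R \<longleftrightarrow> (s, p) \<in> R"
    using ord[OF w'] assms(3) by auto
  ultimately show False using flip by blast
qed

context
  fixes a1 a2 a3 a4 :: 'a and A d
  assumes dist: "distinct [a1, a2, a3, a4]"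
  defines "A \<equiv> {a1, a2, a3, a4}" and "d \<equiv> bonacci4 a1 a2 a3 a4"
begin

lemma bonacci4_rules:
  "d 0 = a1" "d (Suc 0) = a2" "d (Suc (Suc 0)) = a3" "d (Suc (Suc (Suc 0))) = a4"
  "d (Suc (Suc (Suc (Suc 0)))) = a1" "d (Suc (Suc (Suc (Suc (Suc 0))))) = a2"
  by (simp_all add: d_def bonacci4_def)

lemma bonacci4_letters_distinct:
  "a1 \<noteq> a2" "a1 \<noteq> a3" "a1 \<noteq> a4" "a2 \<noteq> a3" "a2 \<noteq> a4" "a3 \<noteq> a4"
  "a2 \<noteq> a1" "a3 \<noteq> a1" "a4 \<noteq> a1" "a3 \<noteq> a2" "a4 \<noteq> a2" "a4 \<noteq> a3"
  using dist by auto

lemmas bonacci4_eval = bonacci4_rules bonacci4_letters_distinct eval_nat_numeral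

lemma bonacci4_directive: "AR_directive A d"
  unfolding AR_directive_def
proof (intro conjI ballI)
  show "range d \<subseteq> A"
  proof
    fix i assume "i \<in> range d"
    then obtain k where k: "i = [a1, a2, a3, a4] ! (k mod 4)"
      by (auto simp: d_def bonacci4_def)
    have "[a1, a2, a3, a4] ! (k mod 4) \<in> set [a1, a2, a3, a4]"
      by (rule nth_mem) simp
    then show "i \<in> A" by (simp add: k A_def)
  qed
  fix i assume "i \<in> A"
  then have "i \<in> set [a1, a2, a3, a4]" by (simp add: A_def)
  then obtain s where "s < length [a1, a2, a3, a4]" and si: "[a1, a2, a3, a4] ! s = i"
    unfolding in_set_conv_nth by blast
  then have s: "s < 4" by simp
  have "d (4 * n + s) = i" for n
    using s si by (simp add: d_def bonacci4_def)
  then have "range (\<lambda>n. 4 * n + s) \<subseteq> {k. d k = i}" by auto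
  moreover have "infinite (range (\<lambda>n::nat. 4 * n + s))"
    using finite_imageD[of "\<lambda>n::nat. 4 * n + s" UNIV] by (auto simp: inj_def)
  ultimately show "infinite {k. d k = i}" using finite_subset by blast
qed

lemma bonacci4_rule_a: "rule_a d = a1"
  by (simp add: rule_a_def bonacci4_rules)

lemma bonacci4_rule_b: "rule_b d = a2"
proof -
  have "(LEAST k. d k \<noteq> a1) = 1"
    by (rule Least_equality) (auto simp: bonacci4_eval Suc_le_eq intro: gr0I)
  then show ?thesis by (simp add: rule_b_def bonacci4_rule_a bonacci4_rules)
qed

lemma bonacci4_lambda2: "lambda2 d = 2"
  unfolding lambda2_def bonacci4_rule_a bonacci4_rule_b
proof (rule Least_equality)
  show "d 2 \<notin> {a1, a2}" by (simp add: bonacci4_eval)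
  fix k assume "d k \<notin> {a1, a2}"
  then have "k \<noteq> 0" "k \<noteq> 1" by (auto simp: bonacci4_rules intro: ccontr)
  then show "2 \<le> k" by simp
qed

lemma bonacci4_mu: "mu_first d a1 = 4" "mu_first d a2 = 5"
proof -
  have three: "d 3 = a4" and four: "d 4 = a1" and five: "d 5 = a2"
    by (simp_all add: bonacci4_eval)
  show "mu_first d a1 = 4"
    unfolding mu_first_def bonacci4_lambda2
  proof (rule Least_equality)
    fix k assume "2 < k \<and> d k = a1"
    moreover then have "k \<noteq> 3" using three bonacci4_letters_distinct by auto
    ultimately show "4 \<le> k" by simp
  qed (simp add: four)
  show "mu_first d a2 = 5"
    unfolding mu_first_def bonacci4_lambda2
  proof (rule Least_equality)
    fix k assume "2 < k \<and> d k = a2"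
    moreover then have "k \<noteq> 3" "k \<noteq> 4" using three four bonacci4_letters_distinct by auto
    ultimately show "5 \<le> k" by simp
  qed (simp add: five)
qed

lemma bonacci4_lambda_last: "lambda_last d a2 = 1"
  unfolding lambda_last_def bonacci4_lambda2
  by (rule Greatest_equality) (auto simp: bonacci4_rules)

lemma bonacci4_w: "AR_w d 1 = [a1]" "AR_w d 2 = [a1, a2, a1]"
  "AR_w d 3 = [a1, a2, a1, a3, a1, a2, a1]"
  by (simp_all add: bonacci4_eval)

lemma bonacci4_block_lengths:
  "length (AR_word d 5 a1) = 15" "length (AR_word d 5 a2) = 29"
  "length (AR_word d 5 a3) = 27" "length (AR_word d 5 a4) = 23"
  "length (AR_word d 6 a1) = 44" "length (AR_word d 6 a2) = 29"
  "length (AR_word d 6 a3) = 56" "length (AR_word d 6 a4) = 52"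
  by (simp_all add: bonacci4_eval)

lemma bonacci4_maxlen: "AR_maxlen A d 6 = 56"
  by (simp add: AR_maxlen_def A_def bonacci4_block_lengths)

text \<open>
  With \<open>w = w_2\<close>, the factors \<open>a3 w a1\<close> and \<open>a1 w a3\<close> occur by \<open>rule_recurrence\<close>, so by
  \<open>three_rules_never_cluster\<close> it is enough to find \<open>a3 w a2\<close> or \<open>a2 w a3\<close>. The first ends at the
  start of the final \<open>A_5^(a2)\<close> of each block of level 6, the second two letters later. As these blocks
  have length at most 56, a word that misses both is confined to at most 57 letters, and with 57
  letters it consists of one letter followed by such a final \<open>A_5^(a2)\<close> and by the \<open>A_5^(a3)\<close> that begins
  the next block \<open>A_6^(a3)\<close>.
\<close>

lemma bonacci4_never_clusters_from_57:
  assumes v: "v \<in> AR_language A d" and len: "57 \<le> length v"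
  shows "never_clusters A v"
proof -
  have fin: "finite A" and card: "3 \<le> card A"
    using dist by (auto simp: A_def)
  note dir = bonacci4_directive
  have rg: "range d \<subseteq> A" using dir by (simp add: AR_directive_def)
  note letters = AR_language_letters[OF v rg]
  let ?w = "AR_w d 2"
  have d2: "d 2 = a3" and d4: "d 4 = a1" and d5: "d 5 = a2"
    by (simp_all add: bonacci4_eval)
  have L5: "length (AR_word d (Suc 4) i) \<le> 29" if "i \<in> A" for i
    using that bonacci4_block_lengths by (auto simp: A_def)
  have ones: "sublist (a3 # ?w @ [a1]) v" "sublist (a1 # ?w @ [a3]) v"
    using rule_recurrence[OF v rg, of 2 4 29] L5 len bonacci4_letters_distinct
    by (simp_all add: d2 d4 bonacci4_w)
  note three = three_rules_never_cluster[OF dir fin card letters,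
      unfolded bonacci4_lambda2 bonacci4_rule_a bonacci4_rule_b d2, OF ones]
  obtain u P S where u: "set u \<subseteq> A" and eq: "AR_blocks d (Suc 5) u = P @ v @ S"
    using v rg by (rule AR_language_blocks)
  let ?f = "\<lambda>u. length (AR_blocks d (Suc 5) u)"
  have "?f u = length P + length v + length S" using eq by simp
  then have "length P + 31 \<le> ?f u" "u \<noteq> []" using len by auto
  \<comment> \<open>A context of \<open>w_2\<close> fits if it ends at position \<open>length P + 4\<close> or later; \<open>a2 w_2 a3\<close> ends 27
    letters before the end of a block of level 6, and \<open>a3 w_2 a2\<close> 29 letters before it.\<close>
  from first_prefix_reaching[of "length P + 31" ?f, OF this]
  obtain u1 j u2 where dec: "u = u1 @ j # u2" and N: "length P + 31 \<le> ?f (u1 @ [j])"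
    and first: "u1 = [] \<or> ?f u1 < length P + 31" by blast
  have "j \<in> A" using dec u by auto
  have s2: "length (AR_word d 2 a2) = 2" by (simp add: bonacci4_eval)
  note occ = rule_occurrence[of 2 5 d P v S u1 j u2, unfolded d2 d5,
      OF _ _ eq[unfolded dec, symmetric], unfolded bonacci4_block_lengths s2 bonacci4_w(2)]
  show ?thesis
  proof (cases "?f (u1 @ [j]) < length P + length v + 29")
    case True
    show ?thesis
    proof (cases "?f (u1 @ [j]) < length P + length v + 27")
      case True
      then have "sublist (a2 # ?w @ [a3]) v"
        using occ(2) N bonacci4_letters_distinct by (simp add: bonacci4_w(2))
      then show ?thesis using three by blast
    next
      case False
      then have "sublist (a3 # ?w @ [a2]) v"
        using occ(1) \<open>?f (u1 @ [j]) < length P + length v + 29\<close> len bonacci4_letters_distinct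
        by (simp add: bonacci4_w(2))
      then show ?thesis using three by blast
    qed
  next
    case False
    have j: "length (AR_word d 6 j) \<le> 56" "j \<noteq> a3 \<Longrightarrow> length (AR_word d 6 j) \<le> 52"
      using \<open>j \<in> A\<close> bonacci4_block_lengths by (auto simp: A_def)
    have six: "Suc 5 = 6" by simp
    have f: "?f (u1 @ [j]) = ?f u1 + length (AR_word d 6 j)" by (simp add: six del: AR_word.simps)
    have "u1 \<noteq> []" using False f j(1) len by auto
    then have fu1: "?f u1 \<le> length P + 30" using first by simp
    have "j = a3" using j(2) f fu1 False len by linarith
    have P: "?f u1 = length P + 30" and v57: "length v = 57"
      using j(1) f fu1 False len by linarith+
    obtain u0 i where "u1 = u0 @ [i]"
      using \<open>u1 \<noteq> []\<close> by (metis rev_exhaust)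
    then obtain r where r: "AR_blocks d (Suc 5) u1 = AR_blocks d 5 r @ AR_word d 5 a2"
      using AR_blocks_ending[of d 5 u0 i] d5 by metis
    let ?m = "AR_word d 5 a2 @ AR_word d 5 a3"
    have "AR_word d (Suc 5) a3 = AR_word d 5 a3 @ AR_word d 5 a2"
      using d5 bonacci4_letters_distinct by (simp only: AR_word.simps if_False)
    then have "P @ v @ S = AR_blocks d 5 r @ ?m @ (AR_word d 5 a2 @ AR_blocks d (Suc 5) u2)"
      using eq r unfolding dec \<open>j = a3\<close> by (simp del: AR_word.simps)
    moreover have "length (AR_blocks d 5 r) = length P + 1"
      using P unfolding r by (simp add: bonacci4_block_lengths)
    ultimately have "sublist ?m v"
      using factor_in_window[of P v S "AR_blocks d 5 r" ?m "AR_word d 5 a2 @ AR_blocks d (Suc 5) u2"]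
      by (simp add: bonacci4_block_lengths v57)
    \<comment> \<open>The positions below are those of the needed factors in the 56 letters of \<open>?m\<close>.\<close>
    have sublist_at: "sublist xs v" if "take (length xs) (drop n ?m) = xs" for xs n
    proof -
      have "sublist (take (length xs) (drop n ?m)) ?m"
        by (metis sublist_drop sublist_order.order_trans sublist_take)
      then show ?thesis using that \<open>sublist ?m v\<close> sublist_order.order_trans by metis
    qed
    have pr: "sublist [a1, a3] v"
      by (rule sublist_at[of _ 1]) (simp add: bonacci4_eval)
    have ps: "sublist [a1, a4] v"
      by (rule sublist_at[of _ 5]) (simp add: bonacci4_eval)
    have qp: "sublist [a2, a1] v"
      by (rule sublist_at[of _ 0]) (simp add: bonacci4_eval)
    have w1: "sublist [a4, a1, a2, a1, a3] v"
      by (rule sublist_at[of _ 6]) (simp add: bonacci4_eval)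
    have w2: "sublist [a3, a1, a2, a1, a1] v"
      by (rule sublist_at[of _ 10]) (simp add: bonacci4_eval)
    have w3: "sublist [a3, a1, a2, a1, a3, a1, a2, a1, a4] v"
      by (rule sublist_at[of _ 25]) (simp add: bonacci4_eval)
    have w4: "sublist [a4, a1, a2, a1, a3, a1, a2, a1, a1] v"
      by (rule sublist_at[of _ 6]) (simp add: bonacci4_eval)
    show ?thesis
      by (rule shared_contexts_never_cluster[OF fin letters dist pr ps qp,
            of ?w "AR_w d 3"]) (simp_all only: bonacci4_w append_Cons append_Nil w1 w2 w3 w4)
  qed
qed

lemma bonacci4_clustering_bound: "57 \<le> N \<Longrightarrow> clustering_bound A d N"
  using bonacci4_never_clusters_from_57 by (auto simp: clustering_bound_def)

end

theorem proposition23: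
  shows
    "(\<forall>(A :: 'a set) d x y v.
        finite A \<and> 3 \<le> card A \<and> AR_directive A d \<and>
        {x, y} = {rule_a d, rule_b d} \<and> mu_first d x < mu_first d y \<and>
        v \<in> AR_language A d \<and>
        length (AR_w d (lambda2 d)) + AR_maxlen A d (mu_first d y + 1) + 1 \<le> length v
        \<longrightarrow> never_clusters A v)
     \<and>
     (\<forall>(a1 :: 'a) a2 a3 a4 A d x y bound better.
        distinct [a1, a2, a3, a4] \<and> A = {a1, a2, a3, a4} \<and> d = bonacci4 a1 a2 a3 a4 \<and>
        {x, y} = {rule_a d, rule_b d} \<and> mu_first d x < mu_first d y \<and>
        bound = length (AR_w d (lambda2 d)) + AR_maxlen A d (mu_first d y + 1) + 1 \<and>
        better = length (AR_w d (lambda_last d y)) + AR_maxlen A d (mu_first d y + 1) + 1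
        \<longrightarrow>
          \<not> optimal_clustering_bound A d bound \<and>
          better < bound \<and>
          clustering_bound A d better \<and>
          \<not> optimal_clustering_bound A d better \<and>
          (\<forall>v\<in>AR_language A d. length v = better - 1 \<longrightarrow> never_clusters A v))"
proof (intro conjI allI impI; (elim conjE)?)
  fix A :: "'a set" and d x y v
  assume "finite A" "3 \<le> card A" "AR_directive A d" "{x, y} = {rule_a d, rule_b d}"
    "mu_first d x < mu_first d y" "v \<in> AR_language A d"
    "length (AR_w d (lambda2 d)) + AR_maxlen A d (mu_first d y + 1) + 1 \<le> length v"
  then show "never_clusters A v" by (rule long_words_never_cluster)
next
  fix a1 a2 a3 a4 :: 'a and A d x y and bound better :: nat
  assume dist: "distinct [a1, a2, a3, a4]"
    and A: "A = {a1, a2, a3, a4}" and d: "d = bonacci4 a1 a2 a3 a4"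
    and xy: "{x, y} = {rule_a d, rule_b d}" and mu: "mu_first d x < mu_first d y"
    and bound: "bound = length (AR_w d (lambda2 d)) + AR_maxlen A d (mu_first d y + 1) + 1"
    and better: "better = length (AR_w d (lambda_last d y)) + AR_maxlen A d (mu_first d y + 1) + 1"
  note lang = bonacci4_mu[OF dist] bonacci4_lambda2[OF dist] bonacci4_lambda_last[OF dist]
    bonacci4_maxlen[OF dist] bonacci4_w[OF dist]
  have "x = a1 \<and> y = a2 \<or> x = a2 \<and> y = a1"
    using xy unfolding d bonacci4_rule_a[OF dist] bonacci4_rule_b[OF dist]
    by (simp add: doubleton_eq_iff)
  then have y: "y = a2"
    using mu unfolding d by (auto simp: lang)
  have b: "bound = 60" "better = 58"
    unfolding bound better y unfolding A d lang by (simp_all add: lang)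
  have cb: "clustering_bound A d N" if "57 \<le> N" for N
    using bonacci4_clustering_bound[OF dist that] by (simp add: A d)
  show "\<not> optimal_clustering_bound A d bound" "\<not> optimal_clustering_bound A d better"
    using cb[of 57] by (auto simp: optimal_clustering_bound_def b intro!: exI[of _ 57])
  show "better < bound" "clustering_bound A d better"
    using cb by (simp_all add: b)
  show "\<forall>v\<in>AR_language A d. length v = better - 1 \<longrightarrow> never_clusters A v"
    using cb[of 57] by (simp add: b clustering_bound_def)
qed

end
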